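(* Let $A\in M_2(\mathbb{Z})$ be an expanding matrix with characteristic polynomial $f(x)=x^2+bx+c$ ($b,c\in\mathbb{Z}$), let $m\geq 1$ be an integer, and let $\mathcal{D}=\{0,1,\dots,m\}v=\{0,v,2v,\dots,mv\}$ where $v\in\mathbb{R}^2$ is such that $\{v,Av\}$ is linearly independent. Suppose that $\Delta=b^2-4c\geq 0$ and that all eigenvalues of $A$ have moduli $\geq 2$. Then: (i) if $c=4$, then $T(A,\mathcal{D})$ is connected if and only if $m\geq 2$; (ii) if $c\neq 4$, then $T(A,\mathcal{D})$ is connected if and only if $$m\geq \begin{cases}\max\{c-|b|+1,\ |b|-1\} & \text{if } c>0,\\ |c|-|b|-1 & \text{if } c<0.\end{cases}$$
   Context: A matrix $A\in M_n(\mathbb{Z})$ is expanding if all its (complex) eigenvalues have moduli strictly greater than $1$. For an expanding $A\in M_n(\mathbb{Z})$ and a finite set $\mathcal{D}\subset\mathbb{R}^n$ (a digit set), the self-affine set $T(A,\mathcal{D})$ is the unique non-empty compact set $T\subset\mathbb{R}^n$ satisfying $T=\bigcup_{d\in\mathcal{D}}A^{-1}(T+d)$; equivalently $T=\left\{\sum_{i=1}^\infty A^{-i}d_{j_i}: d_{j_i}\in\mathcal{D}\right\}$. *)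

theory Defs
  imports "HOL-Analysis.Analysis" "HOL-Computational_Algebra.Polynomial"
begin

abbreviation real_matrix :: "int ^ 'n ^ 'n \<Rightarrow> real ^ 'n ^ 'n" where
  "real_matrix A \<equiv> map_matrix of_int A"

definition eigenvalue :: "int ^ 'n ^ 'n \<Rightarrow> complex \<Rightarrow> bool" where
  "eigenvalue A \<mu> \<longleftrightarrow>
     (\<exists>x :: complex ^ 'n. x \<noteq> 0 \<and> map_matrix of_int A *v x = \<mu> *s x)"

definition expanding :: "int ^ 'n ^ 'n \<Rightarrow> bool" where
  "expanding A \<longleftrightarrow> (\<forall>\<mu>. eigenvalue A \<mu> \<longrightarrow> norm \<mu> > 1)"

text \<open>The determinant of \<open>x I - A\<close>, taken over the polynomial ring.\<close>

definition charpoly :: "int ^ 'n ^ 'n \<Rightarrow> int poly" where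
  "charpoly A = det (mat [:0, 1:] - map_matrix (\<lambda>a. [:a:]) A)"

text \<open>The description determines a set only under the standing assumptions that \<open>A\<close> is
  expanding and \<open>D\<close> is finite and non-empty; \<open>matrix_inv\<close> is then the true inverse.\<close>

definition self_affine_set :: "int ^ 'n ^ 'n \<Rightarrow> (real ^ 'n) set \<Rightarrow> (real ^ 'n) set" where
  "self_affine_set A D =
     (THE T. T \<noteq> {} \<and> compact T \<and>
        T = (\<Union>d\<in>D. (\<lambda>x. matrix_inv (real_matrix A) *v (x + d)) ` T))"

definition collinear_digits :: "int \<Rightarrow> real ^ 'n \<Rightarrow> (real ^ 'n) set" where
  "collinear_digits m v = (\<lambda>k. of_int k *\<^sub>R v) ` {0..m}"

end

theory Submission
  imports Defs
begin

text \<open>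
  Since \<open>{v, A v}\<close> is independent, tracking the tails of an expansion in this basis shows that
  \<open>k v \<in> T - T\<close> holds iff there is a bounded integer sequence \<open>q\<close> with \<open>q 0 = 0\<close>, \<open>q 1 = k\<close> and
  \<open>\<bar>q (n + 2) + b q (n + 1) + c q n\<bar> \<le> m\<close> for all \<open>n\<close>. By Hata's criterion \<open>T\<close> is connected if
  this holds for \<open>k = 1\<close>, and if it is connected then it holds for some \<open>k \<in> {1..m}\<close>.

  If the characteristic roots \<open>r\<close> and \<open>s\<close> have the same sign, then inverting the two first order
  recurrences gives \<open>(\<bar>r\<bar> - 1) (\<bar>s\<bar> - 1) \<bar>q n\<bar> \<le> m\<close>, that is
  \<open>(c - \<bar>b\<bar> + 1) \<bar>q n\<bar> \<le> m\<close>. With \<open>n = 1\<close> this is one of the bounds on \<open>m\<close>; if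
  \<open>m \<le> \<bar>b\<bar> - 2\<close>, then \<open>\<bar>q 2\<bar> \<ge> 2\<close>, and \<open>n = 2\<close> leads to a contradiction unless \<open>c = 4\<close>.
  If the signs differ, evaluating the recurrence where \<open>\<bar>q n\<bar>\<close> is maximal gives
  \<open>\<bar>c\<bar> - \<bar>b\<bar> - 1 \<le> m\<close>. Conversely, constant or alternating sequences attain the bounds.
\<close>

section \<open>Bounded solutions of expanding recurrences\<close>

text \<open>Read backwards, the recurrence contracts: the supremum \<open>M\<close> of the norms
  satisfies \<open>\<bar>l\<bar> * M \<le> M + C\<close>.\<close>

lemma bounded_recurrence_norm_le:
  fixes X :: "nat \<Rightarrow> 'a :: real_normed_vector"
  assumes "bounded (range X)" and l: "\<bar>l\<bar> > 1"
    and C: "\<And>n. norm (X (Suc n) - l *\<^sub>R X n) \<le> C"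
  shows "norm (X n) \<le> C / (\<bar>l\<bar> - 1)"
proof -
  define M where "M = (SUP n. norm (X n))"
  have "bdd_above (range (\<lambda>n. norm (X n)))"
    using assms(1) by (auto simp: bounded_iff bdd_above_def)
  then have M: "norm (X n) \<le> M" for n
    unfolding M_def by (rule cSUP_upper[OF UNIV_I])
  have "norm (X n) \<le> (M + C) / \<bar>l\<bar>" for n
  proof -
    have "\<bar>l\<bar> * norm (X n) = norm (X (Suc n) - (X (Suc n) - l *\<^sub>R X n))"
      by simp
    also have "\<dots> \<le> M + C"
      using norm_triangle_ineq4[of "X (Suc n)" "X (Suc n) - l *\<^sub>R X n"] M[of "Suc n"] C[of n]
      by linarith
    finally show ?thesis
      using l by (simp add: pos_le_divide_eq mult.commute)
  qed
  then have "M \<le> (M + C) / \<bar>l\<bar>"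
    unfolding M_def by (intro cSUP_least) auto
  then have "M \<le> C / (\<bar>l\<bar> - 1)"
    using l by (simp add: field_simps)
  then show ?thesis
    using M[of n] by linarith
qed

text \<open>The second order operator factors into first order ones with multipliers
  \<open>r\<close> and \<open>s\<close>; the first order bound is applied to \<open>y\<close>, then
  to \<open>x\<close>.\<close>

lemma bounded_recurrence2_abs_le:
  fixes x :: "nat \<Rightarrow> real"
  assumes bdd: "bounded (range x)" and r: "\<bar>r\<bar> > 1" and s: "\<bar>s\<bar> > 1"
    and C: "\<And>n. \<bar>x (Suc (Suc n)) - (r + s) * x (Suc n) + r * s * x n\<bar> \<le> C"
  shows "(\<bar>r\<bar> - 1) * (\<bar>s\<bar> - 1) * \<bar>x n\<bar> \<le> C"
proof -
  define y where "y n = x (Suc n) - s * x n" for n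
  obtain M where M: "\<And>n. \<bar>x n\<bar> \<le> M"
    using bdd by (auto simp: bounded_iff)
  have "\<bar>y n\<bar> \<le> M + \<bar>s\<bar> * M" for n
    using M[of "Suc n"] mult_left_mono[OF M[of n], of "\<bar>s\<bar>"]
    unfolding y_def by (simp add: abs_mult[symmetric])
  then have "bounded (range y)"
    by (auto simp: bounded_iff)
  moreover have "norm (y (Suc n) - r *\<^sub>R y n) \<le> C" for n
    using C[of n] by (simp add: y_def algebra_simps)
  ultimately have "norm (y n) \<le> C / (\<bar>r\<bar> - 1)" for n
    using bounded_recurrence_norm_le r by blast
  then have "norm (x (Suc n) - s *\<^sub>R x n) \<le> C / (\<bar>r\<bar> - 1)" for n
    by (simp add: y_def)
  from bounded_recurrence_norm_le[OF bdd s this]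
  have "\<bar>x n\<bar> \<le> C / (\<bar>r\<bar> - 1) / (\<bar>s\<bar> - 1)"
    by simp
  then have "\<bar>x n\<bar> * ((\<bar>r\<bar> - 1) * (\<bar>s\<bar> - 1)) \<le> C"
    using r s by (simp add: pos_le_divide_eq mult.assoc mult.commute)
  then show ?thesis
    by (simp add: mult_ac)
qed

lemma closure_UN_finite: "finite I \<Longrightarrow> closure (\<Union>i\<in>I. S i) = (\<Union>i\<in>I. closure (S i))"
  by (induction I rule: finite_induct) simp_all

section \<open>Self-affine sets of a linear map with a split quadratic relation\<close>

text \<open>\<open>L\<close> models the matrix, \<open>B\<close> its inverse, and
  \<open>quadratic\<close> is Cayley-Hamilton with real roots. Arguing from
  \<open>(L - r) (L - s) = 0\<close> covers the double root \<open>r = s\<close>, where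
  \<open>L\<close> need not be diagonalizable.\<close>

locale split_quadratic =
  fixes L B :: "'a::euclidean_space \<Rightarrow> 'a" and r s :: real
  assumes linear_L: "linear L"
    and LB [simp]: "L (B x) = x" and BL [simp]: "B (L x) = x"
    and quadratic: "L (L x) = (r + s) *\<^sub>R L x - (r * s) *\<^sub>R x"
    and r: "\<bar>r\<bar> \<ge> 2" and s: "\<bar>s\<bar> \<ge> 2"
begin

lemmas L_simps = linear_add[OF linear_L] linear_diff[OF linear_L] linear_scale[OF linear_L]
  linear_0[OF linear_L]

lemma linear_B: "linear B"
proof (rule linearI)
  show "B (x + y) = B x + B y" for x y
    by (metis LB BL L_simps(1))
  show "B (a *\<^sub>R x) = a *\<^sub>R B x" for a x
    by (metis LB BL L_simps(3))
qed

lemmas B_simps = linear_add[OF linear_B] linear_diff[OF linear_B] linear_scale[OF linear_B]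
  linear_0[OF linear_B]

lemma inj_B: "inj B"
  by (metis LB injI)

lemma funpow_B_diff: "(B ^^ n) (x - y) = (B ^^ n) x - (B ^^ n) y"
  by (induction n) (simp_all add: B_simps)

text \<open>On the range of \<open>L - s\<close> the map \<open>B\<close> is multiplication by \<open>1 / r\<close>.\<close>

lemma norm_funpow_B_le: "2 ^ n * norm ((B ^^ n) x) \<le> norm x + n * norm (L x - s *\<^sub>R x)"
proof -
  define z where "z n = L ((B ^^ n) x) - s *\<^sub>R (B ^^ n) x" for n
  have rz: "r *\<^sub>R z (Suc n) = z n" for n
    by (simp add: z_def algebra_simps quadratic[of "B ((B ^^ n) x)", simplified])
  have z: "2 ^ n * norm (z n) \<le> norm (z 0)" for n
  proof (induction n)
    case (Suc n)
    have "2 * norm (z (Suc n)) \<le> \<bar>r\<bar> * norm (z (Suc n))"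
      by (intro mult_right_mono r) simp
    also have "\<dots> = norm (z n)"
      by (metis rz norm_scaleR)
    finally have "2 ^ n * (2 * norm (z (Suc n))) \<le> 2 ^ n * norm (z n)"
      by (intro mult_left_mono) auto
    with Suc have "2 ^ n * (2 * norm (z (Suc n))) \<le> norm (z 0)"
      by linarith
    then show ?case
      by (simp add: mult_ac)
  qed simp
  \<comment> \<open>Since \<open>(B ^^ n) x = s *\<^sub>R (B ^^ Suc n) x + z (Suc n)\<close>, each
    step adds at most \<open>norm (z 0)\<close>; the resulting factor \<open>n\<close> allows for a
    Jordan block.\<close>
  show ?thesis
  proof (induction n)
    case (Suc n)
    have "2 * norm ((B ^^ Suc n) x) \<le> \<bar>s\<bar> * norm ((B ^^ Suc n) x)"
      by (intro mult_right_mono s) simp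
    also have "\<dots> = norm ((B ^^ n) x - z (Suc n))"
      by (simp add: z_def)
    also have "\<dots> \<le> norm ((B ^^ n) x) + norm (z (Suc n))"
      by (rule norm_triangle_ineq4)
    finally have "2 ^ n * (2 * norm ((B ^^ Suc n) x)) \<le> 2 ^ n * (norm ((B ^^ n) x) + norm (z (Suc n)))"
      by (intro mult_left_mono) auto
    moreover have "2 ^ n * norm (z (Suc n)) \<le> 2 ^ Suc n * norm (z (Suc n))"
      by (intro mult_right_mono) auto
    then have "2 ^ n * norm (z (Suc n)) \<le> norm (z 0)"
      using z[of "Suc n"] by linarith
    ultimately have "2 ^ n * (2 * norm ((B ^^ Suc n) x)) \<le> norm x + n * norm (z 0) + norm (z 0)"
      using Suc by (simp add: z_def distrib_left)
    then show ?case
      by (simp add: z_def distrib_right mult_ac)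
  qed simp
qed

text \<open>One \<open>n\<close> serves all of \<open>U\<close>: all tails of an orbit at once, or
  all differences of points of \<open>T\<close> in the chain argument.\<close>

lemma funpow_B_small:
  assumes "bounded U" and "e > 0"
  obtains n where "\<And>x. x \<in> U \<Longrightarrow> norm ((B ^^ n) x) < e"
proof -
  obtain M where M: "\<And>x. x \<in> U \<Longrightarrow> norm x \<le> M"
    using assms(1) by (auto simp: bounded_iff)
  have "linear (\<lambda>x. L x - s *\<^sub>R x)"
    by (intro linear_compose_sub linear_L linear_scale_self)
  then have "bounded ((\<lambda>x. L x - s *\<^sub>R x) ` U)"
    using assms(1) by (simp add: bounded_linear_image linear_conv_bounded_linear)
  then obtain K where K: "\<And>x. x \<in> U \<Longrightarrow> norm (L x - s *\<^sub>R x) \<le> K"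
    by (auto simp: bounded_iff)
  have "(\<lambda>n. M * (1 / 2) ^ n + K * (real n * (1 / 2) ^ n)) \<longlonglongrightarrow> M * 0 + K * 0"
    by (intro tendsto_add tendsto_mult tendsto_const powser_times_n_limit_0 LIMSEQ_power_zero) auto
  then have "\<forall>\<^sub>F n in sequentially. M * (1 / 2) ^ n + K * (real n * (1 / 2) ^ n) < e"
    using order_tendstoD(2) assms(2) by fastforce
  then obtain n where n: "M * (1 / 2) ^ n + K * (real n * (1 / 2) ^ n) < e"
    using eventually_happens trivial_limit_sequentially by blast
  show ?thesis
  proof
    fix x assume x: "x \<in> U"
    have "2 ^ n * norm ((B ^^ n) x) \<le> M + n * K"
      using norm_funpow_B_le[of n x] M[OF x] mult_left_mono[OF K[OF x], of n] by simp
    then have "norm ((B ^^ n) x) \<le> M * (1 / 2) ^ n + K * (real n * (1 / 2) ^ n)"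
      by (simp add: field_simps)
    with n show "norm ((B ^^ n) x) < e"
      by linarith
  qed
qed

section \<open>Self-affine sets as sets of bounded orbits\<close>

definition self_affine :: "'a set \<Rightarrow> 'a set \<Rightarrow> bool" where
  "self_affine D T \<longleftrightarrow> T \<noteq> {} \<and> compact T \<and> T = (\<Union>d\<in>D. (\<lambda>x. B (x + d)) ` T)"

lemma self_affineD:
  assumes "self_affine D T"
  shows "T \<noteq> {}" and "compact T" and "T = (\<Union>d\<in>D. (\<lambda>x. B (x + d)) ` T)"
  using assms unfolding self_affine_def by blast+

lemma self_affine_mem_iff:
  assumes "self_affine D T"
  shows "x \<in> T \<longleftrightarrow> (\<exists>d\<in>D. \<exists>y\<in>T. x = B (y + d))"
  by (subst self_affineD(3)[OF assms]) (simp add: image_iff)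

text \<open>The sum of \<open>B ^ i d\<^sub>i\<close> over \<open>i \<ge> 1\<close> is encoded by its sequence of tails, which are
  the bounded orbits of \<open>x \<mapsto> L x - d\<close>; this avoids infinite series.\<close>

definition attractor :: "'a set \<Rightarrow> 'a set" where
  "attractor D = {x. \<exists>X. X 0 = x \<and> bounded (range X) \<and> (\<forall>n::nat. L (X n) - X (Suc n) \<in> D)}"

lemma attractorI:
  "X 0 = x \<Longrightarrow> bounded (range X) \<Longrightarrow> (\<And>n. L (X n) - X (Suc n) \<in> D) \<Longrightarrow> x \<in> attractor D"
  by (auto simp: attractor_def)

lemma attractorE:
  assumes "x \<in> attractor D"
  obtains X where "X 0 = x" "bounded (range X)" "\<And>n. L (X n) - X (Suc n) \<in> D"
  using assms unfolding attractor_def by blast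

text \<open>A constant orbit is enough, that is, a fixed point of
  \<open>x \<mapsto> L x - d\<close>.\<close>

lemma attractor_nonempty:
  assumes "D \<noteq> {}"
  shows "attractor D \<noteq> {}"
proof -
  obtain d where d: "d \<in> D"
    using assms by auto
  define a where "a = (1 - r) * (1 - s)"
  have "r \<noteq> 1" "s \<noteq> 1"
    using r s by auto
  then have a: "a \<noteq> 0"
    by (simp add: a_def)
  \<comment> \<open>The quadratic relation gives \<open>(L - 1) (L + 1 - r - s) = - a\<close>, which
    inverts \<open>L - 1\<close>.\<close>
  define y where "y = L d + (1 - r - s) *\<^sub>R d"
  define x where "x = - (1 / a) *\<^sub>R y"
  have "L y - y = - a *\<^sub>R d"
    by (simp add: y_def L_simps quadratic a_def algebra_simps)
  have "L x - x = - (1 / a) *\<^sub>R (L y - y)"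
    by (simp add: x_def L_simps algebra_simps linear_neg[OF linear_L])
  also have "\<dots> = d"
    using a by (simp add: \<open>L y - y = _\<close>)
  finally have "x \<in> attractor D"
    using d by (intro attractorI[of "\<lambda>_. x"]) auto
  then show ?thesis
    by auto
qed

lemma attractor_eq: "attractor D = (\<Union>d\<in>D. (\<lambda>x. B (x + d)) ` attractor D)"
proof (intro equalityI subsetI)
  fix x assume "x \<in> attractor D"
  then obtain X where X: "X 0 = x" "bounded (range X)" "\<And>n. L (X n) - X (Suc n) \<in> D"
    using attractorE by blast
  have "bounded (range (\<lambda>n. X (Suc n)))"
    using X(2) by (rule bounded_subset) auto
  then have "X 1 \<in> attractor D"
    using X(3) by (intro attractorI[of "\<lambda>n. X (Suc n)"]) auto
  moreover have "x = B (X 1 + (L (X 0) - X (Suc 0)))"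
    by (simp add: X(1))
  ultimately show "x \<in> (\<Union>d\<in>D. (\<lambda>x. B (x + d)) ` attractor D)"
    using X(3)[of 0] by blast
next
  fix x assume "x \<in> (\<Union>d\<in>D. (\<lambda>x. B (x + d)) ` attractor D)"
  then obtain d y where d: "d \<in> D" "y \<in> attractor D" "x = B (y + d)"
    by auto
  then obtain X where X: "X 0 = y" "bounded (range X)" "\<And>n. L (X n) - X (Suc n) \<in> D"
    using attractorE by blast
  have "range (case_nat x X) \<subseteq> insert x (range X)"
    by (auto split: nat.splits)
  then have "bounded (range (case_nat x X))"
    using X(2) bounded_subset bounded_insert by blast
  then show "x \<in> attractor D"
    using d X by (intro attractorI[of "case_nat x X"]) (auto split: nat.splits)
qed

text \<open>The bound must not depend on the orbit. As \<open>(L - r) (L - s) = 0\<close>, the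
  images of an orbit under \<open>P = L - s\<close> obey a first order recurrence with multiplier
  \<open>r\<close>; the orbit itself then obeys one with multiplier \<open>s\<close>.\<close>

lemma bounded_attractor:
  assumes "bounded D"
  shows "bounded (attractor D)"
proof -
  define P where "P x = L x - s *\<^sub>R x" for x
  have "linear P"
    unfolding P_def by (intro linear_compose_sub linear_L linear_scale_self)
  then have P: "bounded (P ` U)" if "bounded U" for U
    using that by (simp add: bounded_linear_image linear_conv_bounded_linear)
  obtain M where M: "\<And>d. d \<in> D \<Longrightarrow> norm d \<le> M"
    using assms by (auto simp: bounded_iff)
  obtain K where K: "\<And>d. d \<in> D \<Longrightarrow> norm (P d) \<le> K"
    using P[OF assms] by (auto simp: bounded_iff)
  have "norm x \<le> (K / (\<bar>r\<bar> - 1) + M) / (\<bar>s\<bar> - 1)" if x: "x \<in> attractor D" for x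
  proof -
    obtain X where X: "X 0 = x" "bounded (range X)" "\<And>n. L (X n) - X (Suc n) \<in> D"
      using x attractorE by blast
    have "norm (P (X (Suc n)) - r *\<^sub>R P (X n)) \<le> K" for n
    proof -
      have "P (X (Suc n)) - r *\<^sub>R P (X n) = - P (L (X n) - X (Suc n))"
        by (simp add: P_def L_simps quadratic algebra_simps)
      then show ?thesis
        using K[OF X(3)[of n]] by simp
    qed
    moreover have "bounded (range (\<lambda>n. P (X n)))"
      using P[OF X(2)] by (simp add: image_image)
    ultimately have PX: "norm (P (X n)) \<le> K / (\<bar>r\<bar> - 1)" for n
      using bounded_recurrence_norm_le[of "\<lambda>n. P (X n)" r K] r by auto
    have "norm (X (Suc n) - s *\<^sub>R X n) \<le> K / (\<bar>r\<bar> - 1) + M" for n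
    proof -
      have "X (Suc n) - s *\<^sub>R X n = P (X n) - (L (X n) - X (Suc n))"
        by (simp add: P_def)
      also have "norm \<dots> \<le> norm (P (X n)) + norm (L (X n) - X (Suc n))"
        by (rule norm_triangle_ineq4)
      finally show ?thesis
        using PX[of n] M[OF X(3)[of n]] by linarith
    qed
    from bounded_recurrence_norm_le[OF X(2) _ this, of 0] show ?thesis
      using s X(1) by auto
  qed
  then show ?thesis
    by (auto simp: bounded_iff)
qed

text \<open>Each point of \<open>T\<close> has a successor in \<open>T\<close>, and compactness
  bounds the orbit so chosen.\<close>

lemma self_affine_subset_attractor:
  assumes "self_affine D T"
  shows "T \<subseteq> attractor D"
proof
  fix x assume x: "x \<in> T"
  have "\<exists>z\<in>T. L y - z \<in> D" if y: "y \<in> T" for y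
  proof -
    obtain d z where "d \<in> D" "z \<in> T" "y = B (z + d)"
      using iffD1[OF self_affine_mem_iff[OF assms] y] by blast
    then show ?thesis
      by (intro bexI[of _ z]) auto
  qed
  then obtain g where g: "\<And>y. y \<in> T \<Longrightarrow> g y \<in> T" "\<And>y. y \<in> T \<Longrightarrow> L y - g y \<in> D"
    by metis
  have T: "(g ^^ n) x \<in> T" for n
    by (induction n) (simp_all add: x g)
  have "bounded T"
    using self_affineD(2)[OF assms] by (rule compact_imp_bounded)
  then have "bounded (range (\<lambda>n. (g ^^ n) x))"
    by (rule bounded_subset) (auto simp: T)
  then show "x \<in> attractor D"
    by (intro attractorI[of "\<lambda>n. (g ^^ n) x"]) (auto simp: T g)
qed

text \<open>\<open>x\<close> is a limit of points of \<open>T\<close> whose expansions share more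
  and more initial digits with that of \<open>x\<close>.\<close>

lemma attractor_subset_self_affine:
  assumes "self_affine D T"
  shows "attractor D \<subseteq> T"
proof
  have T: "T \<noteq> {}" "compact T"
    using self_affineD(1,2)[OF assms] .
  obtain t where t: "t \<in> T"
    using T(1) by auto
  fix x assume "x \<in> attractor D"
  then obtain X where X: "X 0 = x" "bounded (range X)" "\<And>n. L (X n) - X (Suc n) \<in> D"
    using attractorE by blast
  text \<open>The tail \<open>X n\<close> of the expansion of \<open>x\<close> is replaced by the point \<open>t\<close>.\<close>
  have approx: "X k + (B ^^ n) (t - X (k + n)) \<in> T" for k n
  proof (induction n arbitrary: k)
    case 0
    then show ?case by (simp add: t)
  next
    case (Suc n)
    define y where "y = X (Suc k) + (B ^^ n) (t - X (Suc k + n))"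
    have "B (y + (L (X k) - X (Suc k))) \<in> T"
      using Suc[of "Suc k"] X(3)[of k] unfolding y_def[symmetric] self_affine_mem_iff[OF assms, of "B _"]
      by blast
    then show ?case
      by (simp add: y_def B_simps add.commute)
  qed
  have "bounded ((\<lambda>n. t - X n) ` UNIV)"
    using X(2) by (intro bounded_minus_comp) (auto intro: bounded_subset[of "{t}"])
  then have "x \<in> closure T"
  proof (intro iffD2[OF closure_approachable] allI impI)
    fix e :: real assume e: "e > 0"
    obtain N where "\<And>y. y \<in> range (\<lambda>n. t - X n) \<Longrightarrow> norm ((B ^^ N) y) < e"
      using funpow_B_small[OF \<open>bounded (range (\<lambda>n. t - X n))\<close> e] by metis
    then have "norm ((B ^^ N) (t - X N)) < e"
      by auto
    then show "\<exists>y\<in>T. dist y x < e"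
      using approx[of 0 N] X(1) by (intro bexI[of _ "x + (B ^^ N) (t - X N)"]) (auto simp: dist_norm)
  qed
  then show "x \<in> T"
    using T(2) by (simp add: compact_imp_closed)
qed

lemma self_affine_attractor_unique: "self_affine D T \<Longrightarrow> T = attractor D"
  using self_affine_subset_attractor attractor_subset_self_affine by blast

text \<open>Closedness of the attractor comes indirectly: its closure is compact and satisfies the
  same set equation, so uniqueness identifies the two.\<close>

lemma self_affine_attractor:
  assumes "finite D" and "D \<noteq> {}"
  shows "self_affine D (attractor D)"
proof -
  define T where "T = attractor D"
  have shift: "closure ((\<lambda>x. B (x + d)) ` T) = (\<lambda>x. B (x + d)) ` closure T" for d
  proof -
    have "closure (B ` (+) d ` T) = B ` (+) d ` closure T"
      using closure_injective_linear_image[OF linear_B inj_B] closure_translation by metis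
    then show ?thesis
      by (simp add: image_image add.commute)
  qed
  have "closure T = closure (\<Union>d\<in>D. (\<lambda>x. B (x + d)) ` T)"
    using attractor_eq[of D] by (simp add: T_def)
  also have "\<dots> = (\<Union>d\<in>D. (\<lambda>x. B (x + d)) ` closure T)"
    using assms(1) by (simp add: closure_UN_finite shift)
  finally have "self_affine D (closure T)"
    using attractor_nonempty[OF assms(2)] bounded_attractor[OF finite_imp_bounded[OF assms(1)]]
    by (simp add: self_affine_def T_def)
  then show ?thesis
    using self_affine_attractor_unique by metis
qed

lemma the_self_affine:
  assumes "finite D" and "D \<noteq> {}"
  shows "(THE T. T \<noteq> {} \<and> compact T \<and> T = (\<Union>d\<in>D. (\<lambda>x. B (x + d)) ` T)) = attractor D"
  using self_affine_attractor[OF assms] self_affine_attractor_unique[of D]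
  unfolding self_affine_def by (rule the_equality)

text \<open>By uniqueness it suffices that the differences of points satisfy the set equation for
  the differences of digits; this holds because \<open>B\<close> is linear.\<close>

lemma attractor_differences:
  assumes "finite D" and "D \<noteq> {}"
  shows "{x - y |x y. x \<in> attractor D \<and> y \<in> attractor D} =
    attractor {d - d' |d d'. d \<in> D \<and> d' \<in> D}"
proof (rule self_affine_attractor_unique)
  define T where "T = attractor D"
  have T: "T \<noteq> {}" "compact T"
    unfolding T_def using self_affineD(1,2)[OF self_affine_attractor[OF assms]] .
  have T': "x \<in> T \<longleftrightarrow> (\<exists>d\<in>D. \<exists>y\<in>T. x = B (y + d))" for x
    unfolding T_def by (rule self_affine_mem_iff[OF self_affine_attractor[OF assms]])
  let ?T = "{x - y |x y. x \<in> T \<and> y \<in> T}"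
  let ?E = "{d - d' |d d'. d \<in> D \<and> d' \<in> D}"
  have "?T = (\<Union>e\<in>?E. (\<lambda>x. B (x + e)) ` ?T)" (is "?l = ?r")
  proof (intro equalityI subsetI)
    fix z assume "z \<in> ?l"
    then obtain x y where "x \<in> T" "y \<in> T" and z: "z = x - y"
      by auto
    then obtain d x' d' y' where *: "d \<in> D" "x' \<in> T" "d' \<in> D" "y' \<in> T"
      and "x = B (x' + d)" "y = B (y' + d')"
      by (meson T')
    then have "z = B ((x' - y') + (d - d'))"
      by (simp add: z B_simps)
    moreover have "x' - y' \<in> ?T" "d - d' \<in> ?E"
      using * by auto
    ultimately show "z \<in> ?r"
      by (intro UN_I[of "d - d'"] image_eqI[of _ _ "x' - y'"])
  next
    fix z assume "z \<in> ?r"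
    then obtain d d' x y where *: "d \<in> D" "d' \<in> D" "x \<in> T" "y \<in> T"
      and "z = B ((x - y) + (d - d'))"
      by auto
    then have "z = B (x + d) - B (y + d')"
      by (simp add: B_simps)
    moreover have "B (x + d) \<in> T" "B (y + d') \<in> T"
      using * by (meson T')+
    ultimately show "z \<in> ?l"
      by auto
  qed
  moreover have "compact ?T"
    by (rule compact_differences[OF T(2) T(2)])
  moreover have "?T \<noteq> {}"
    using T(1) by auto
  ultimately show "self_affine {d - d' |d d'. d \<in> D \<and> d' \<in> D}
      {x - y |x y. x \<in> attractor D \<and> y \<in> attractor D}"
    unfolding self_affine_def T_def by (intro conjI)
qed

section \<open>Collinear digits\<close>

text \<open>An orbit from \<open>k v\<close> keeps integer coordinates \<open>p n\<close>,
  \<open>q n\<close> in the basis \<open>v\<close>, \<open>L v\<close>. One coordinate equation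
  gives \<open>p n = q (Suc n) + b * q n\<close>, and eliminating \<open>p\<close> leaves the
  recurrence in \<open>q\<close>.\<close>

lemma multiple_mem_attractor_iff:
  fixes b c k m :: int
  assumes v: "v \<noteq> L v" "independent {v, L v}"
    and b: "r + s = - of_int b" and c: "r * s = of_int c"
  shows "of_int k *\<^sub>R v \<in> attractor ((\<lambda>e. of_int e *\<^sub>R v) ` {-m..m}) \<longleftrightarrow>
    (\<exists>q :: nat \<Rightarrow> int. bounded (range (\<lambda>n. real_of_int (q n))) \<and> q 0 = 0 \<and> q 1 = k \<and>
      (\<forall>n. \<bar>q (Suc (Suc n)) + b * q (Suc n) + c * q n\<bar> \<le> m))"
    (is "?x \<in> attractor ?D \<longleftrightarrow> _")
proof
  assume "?x \<in> attractor ?D"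
  then obtain X where X: "X 0 = ?x" "bounded (range X)" "\<And>n. L (X n) - X (Suc n) \<in> ?D"
    using attractorE by blast
  have "\<exists>e\<in>{-m..m}. L (X n) - X (Suc n) = of_int e *\<^sub>R v" for n
    using X(3)[of n] by auto
  then obtain e where e: "\<And>n. e n \<in> {-m..m}" "\<And>n. L (X n) - X (Suc n) = of_int (e n) *\<^sub>R v"
    by metis
  define w where "w = rec_nat (k, 0) (\<lambda>n (p, q). (- c * q - e n, p - b * q))"
  define p q where "p n = fst (w n)" and "q n = snd (w n)" for n
  have pq0: "p 0 = k" "q 0 = 0"
    by (simp_all add: p_def q_def w_def)
  have pq: "p (Suc n) = - c * q n - e n" "q (Suc n) = p n - b * q n" for n
    by (simp_all add: p_def q_def w_def split: prod.splits)
  have Xpq: "X n = of_int (p n) *\<^sub>R v + of_int (q n) *\<^sub>R L v" for n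
  proof (induction n)
    case 0
    then show ?case by (simp add: X(1) pq0)
  next
    case (Suc n)
    have "X (Suc n) = L (X n) - of_int (e n) *\<^sub>R v"
      by (simp add: e(2)[symmetric])
    then show ?case
      by (simp add: Suc pq L_simps quadratic b c algebra_simps)
  qed
  \<comment> \<open>The coordinate map is injective, hence bounded below, so a bounded orbit has
    bounded coordinates. \<open>v \<noteq> L v\<close> keeps \<open>{v, L v}\<close> from collapsing
    to one element.\<close>
  define f where "f z = fst z *\<^sub>R v + snd z *\<^sub>R L v" for z :: "real \<times> real"
  have "linear f"
    by (intro linearI) (auto simp: f_def algebra_simps)
  moreover have "inj f"
  proof (rule linear_injective_0[OF \<open>linear f\<close>, THEN iffD2], intro allI impI)
    fix z assume "f z = 0"
    then have "(\<Sum>u\<in>{v, L v}. (if u = v then fst z else snd z) *\<^sub>R u) = 0"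
      using v(1) by (simp add: f_def)
    from independentD[OF v(2) _ subset_refl this]
    have "(if u = v then fst z else snd z) = 0" if "u \<in> {v, L v}" for u
      using that by simp
    from this[of v] this[of "L v"] show "z = 0"
      using v(1) by (simp add: prod_eq_iff)
  qed
  ultimately obtain \<delta> where \<delta>: "\<delta> > 0" "\<And>z. \<delta> * norm z \<le> norm (f z)"
    using linear_inj_bounded_below_pos by blast
  obtain M where M: "\<And>n. norm (X n) \<le> M"
    using X(2) by (auto simp: bounded_iff)
  have "\<bar>real_of_int (q n)\<bar> \<le> M / \<delta>" for n
  proof -
    define z where "z = (real_of_int (p n), real_of_int (q n))"
    have "\<delta> * norm (snd z) \<le> \<delta> * norm z"
      using \<delta>(1) norm_snd_le[of "snd z" "fst z"] by (intro mult_left_mono) auto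
    also have "\<dots> \<le> norm (X n)"
      using \<delta>(2)[of z] by (simp add: Xpq f_def z_def)
    also have "\<dots> \<le> M"
      by (rule M)
    finally show ?thesis
      using \<delta>(1) by (simp add: z_def field_simps)
  qed
  then have "bounded (range (\<lambda>n. real_of_int (q n)))"
    by (auto simp: bounded_iff)
  moreover have "\<bar>q (Suc (Suc n)) + b * q (Suc n) + c * q n\<bar> \<le> m" for n
    using e(1)[of n] by (simp add: pq algebra_simps abs_le_iff)
  ultimately show "\<exists>q :: nat \<Rightarrow> int. bounded (range (\<lambda>n. real_of_int (q n))) \<and> q 0 = 0 \<and> q 1 = k \<and>
      (\<forall>n. \<bar>q (Suc (Suc n)) + b * q (Suc n) + c * q n\<bar> \<le> m)"
    using pq0 pq(2)[of 0] by (intro exI[of _ q]) auto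
next
  assume "\<exists>q :: nat \<Rightarrow> int. bounded (range (\<lambda>n. real_of_int (q n))) \<and> q 0 = 0 \<and> q 1 = k \<and>
      (\<forall>n. \<bar>q (Suc (Suc n)) + b * q (Suc n) + c * q n\<bar> \<le> m)"
  then obtain q :: "nat \<Rightarrow> int" where bdd: "bounded (range (\<lambda>n. real_of_int (q n)))"
    and q: "q 0 = 0" "q 1 = k" "\<And>n. \<bar>q (Suc (Suc n)) + b * q (Suc n) + c * q n\<bar> \<le> m"
    by blast
  \<comment> \<open>The coefficient of \<open>v\<close> is the coordinate \<open>p n\<close> that
    was eliminated in the other direction.\<close>
  define X where "X n = of_int (q (Suc n) + b * q n) *\<^sub>R v + of_int (q n) *\<^sub>R L v" for n
  obtain M where M: "\<And>n. \<bar>real_of_int (q n)\<bar> \<le> M"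
    using bdd by (auto simp: bounded_iff)
  have "norm (X n) \<le> (M + \<bar>b\<bar> * M) * norm v + M * norm (L v)" for n
  proof -
    have "norm (X n) \<le> \<bar>real_of_int (q (Suc n) + b * q n)\<bar> * norm v + \<bar>real_of_int (q n)\<bar> * norm (L v)"
      unfolding X_def by (rule order_trans[OF norm_triangle_ineq]) simp
    moreover have "\<bar>real_of_int (q (Suc n) + b * q n)\<bar> \<le> M + \<bar>b\<bar> * M"
      using M[of "Suc n"] mult_left_mono[OF M[of n], of "\<bar>b\<bar>"]
        abs_triangle_ineq[of "real_of_int (q (Suc n))" "real_of_int (b * q n)"]
      by (simp add: abs_mult)
    ultimately show ?thesis
      using M[of n] by (meson add_mono mult_right_mono norm_ge_zero order_trans)
  qed
  then have "bounded (range X)"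
    unfolding bounded_iff by blast
  moreover have "L (X n) - X (Suc n) \<in> ?D" for n
  proof
    show "L (X n) - X (Suc n) = of_int (- (q (Suc (Suc n)) + b * q (Suc n) + c * q n)) *\<^sub>R v"
      by (simp add: X_def L_simps quadratic b c algebra_simps)
    show "- (q (Suc (Suc n)) + b * q (Suc n) + c * q n) \<in> {-m..m}"
      using q(3)[of n] by auto
  qed
  ultimately show "?x \<in> attractor ?D"
    using q(1,2) by (intro attractorI[of X]) (auto simp: X_def)
qed

text \<open>Hata's argument: pieces of level \<open>n\<close> overlap consecutively, so any two points are joined
  by a chain whose steps shrink to \<open>0\<close> as \<open>n\<close> grows.\<close>

lemma connected_self_affine:
  fixes m :: int
  assumes T: "self_affine ((\<lambda>k. of_int k *\<^sub>R v) ` {0..m}) T"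
    and xy: "x\<^sub>0 \<in> T" "y\<^sub>0 \<in> T" "x\<^sub>0 - y\<^sub>0 = v"
  shows "connected T"
proof -
  have "compact T"
    using self_affineD(2)[OF T] .
  define F where "F k x = B (x + of_int k *\<^sub>R v)" for k :: int and x
  have FT: "F k x \<in> T" if "k \<in> {0..m}" "x \<in> T" for k x
    using that unfolding F_def self_affine_mem_iff[OF T, of "B _"] by blast
  have TF: "\<exists>k\<in>{0..m}. \<exists>y\<in>T. x = F k y" if "x \<in> T" for x
    using that unfolding F_def self_affine_mem_iff[OF T, of x] by blast
  \<comment> \<open>Links of level \<open>n\<close> have differences in the image of
    \<open>T - T\<close> under \<open>B ^^ n\<close>, hence become uniformly short.\<close>
  define R where "R n = {(x, y). x \<in> T \<and> y \<in> T \<and> (\<exists>a\<in>T. \<exists>b\<in>T. x - y = (B ^^ n) (a - b))}" for n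
  have chain: "(x, y) \<in> (R n)\<^sup>*" if "x \<in> T" "y \<in> T" for x y n
    using that
  proof (induction n arbitrary: x y)
    case 0
    then show ?case
      by (intro r_into_rtrancl) (auto simp: R_def)
  next
    case (Suc n)
    \<comment> \<open>\<open>F k\<close> turns a chain of level \<open>n\<close> into one of level
      \<open>Suc n\<close> inside a single piece.\<close>
    have piece: "(F k x, F k y) \<in> (R (Suc n))\<^sup>*" if k: "k \<in> {0..m}" and "x \<in> T" "y \<in> T" for k x y
      using Suc.IH[OF that(2,3)]
    proof (induction rule: rtrancl_induct)
      case (step y z)
      then obtain a b where ab: "y \<in> T" "z \<in> T" "a \<in> T" "b \<in> T" "y - z = (B ^^ n) (a - b)"
        by (auto simp: R_def)
      have "F k y - F k z = (B ^^ Suc n) (a - b)"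
        by (simp add: F_def ab(5)[symmetric] flip: B_simps)
      then have "(F k y, F k z) \<in> R (Suc n)"
        using ab k by (auto simp: R_def FT simp del: funpow.simps)
      with step.IH show ?case
        by simp
    qed simp
    have pieces: "(F i x, F (i + int j) y) \<in> (R (Suc n))\<^sup>*"
      if "0 \<le> i" "i + int j \<le> m" "x \<in> T" "y \<in> T" for i j x y
      using that
    proof (induction j arbitrary: y)
      case 0
      then show ?case
        using piece[of i x y] by simp
    next
      case (Suc j)
      have "(F i x, F (i + int j) x\<^sub>0) \<in> (R (Suc n))\<^sup>*"
        using Suc xy by simp
      \<comment> \<open>Pieces of consecutive digits share this point because
        \<open>x\<^sub>0 - y\<^sub>0 = v\<close>.\<close>
      moreover have "F (i + int j) x\<^sub>0 = F (i + int (Suc j)) y\<^sub>0"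
        using xy(3) by (simp add: F_def algebra_simps)
      moreover have "(F (i + int (Suc j)) y\<^sub>0, F (i + int (Suc j)) y) \<in> (R (Suc n))\<^sup>*"
        using Suc xy by (intro piece) auto
      ultimately show ?case
        by (metis rtrancl_trans)
    qed
    have "sym (R (Suc n))"
    proof (rule symI)
      fix x y assume "(x, y) \<in> R (Suc n)"
      then obtain a b where ab: "x \<in> T" "y \<in> T" "a \<in> T" "b \<in> T" "x - y = (B ^^ Suc n) (a - b)"
        unfolding R_def by blast
      then have "y - x = (B ^^ Suc n) (b - a)"
        unfolding funpow_B_diff by (metis minus_diff_eq)
      with ab show "(y, x) \<in> R (Suc n)"
        unfolding R_def by blast
    qed
    then have sym: "sym ((R (Suc n))\<^sup>*)"
      by (rule sym_rtrancl)
    obtain i j x' y' where ij: "i \<in> {0..m}" "j \<in> {0..m}" "x' \<in> T" "y' \<in> T" "x = F i x'" "y = F j y'"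
      using TF Suc.prems by meson
    show ?case
    proof (cases "i \<le> j")
      case True
      then show ?thesis
        using pieces[of i "nat (j - i)" x' y'] ij by simp
    next
      case False
      then show ?thesis
        using symD[OF sym pieces[of j "nat (i - j)" y' x']] ij by simp
    qed
  qed
  show ?thesis
    unfolding connected_closed_set[OF compact_imp_closed[OF \<open>compact T\<close>]]
  proof
    assume "\<exists>P Q. closed P \<and> closed Q \<and> P \<noteq> {} \<and> Q \<noteq> {} \<and> P \<union> Q = T \<and> P \<inter> Q = {}"
    then obtain P Q a b where PQ: "closed P" "closed Q" "P \<union> Q = T" "P \<inter> Q = {}"
      and ab: "a \<in> P" "b \<in> Q"
      by blast
    then have "P \<inter> T = P"
      by blast
    then have "compact P"
      using closed_Int_compact[OF PQ(1) \<open>compact T\<close>] by simp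
    \<comment> \<open>The two parts are at positive distance, so a chain with links shorter than
      \<open>\<delta>\<close> cannot cross from \<open>P\<close> to \<open>Q\<close>.\<close>
    then obtain \<delta> where \<delta>: "\<delta> > 0" "\<And>x y. x \<in> P \<Longrightarrow> y \<in> Q \<Longrightarrow> \<delta> \<le> dist x y"
      using separate_compact_closed PQ by metis
    define U where "U = {x - y |x y. x \<in> T \<and> y \<in> T}"
    have "bounded U"
      unfolding U_def by (intro compact_imp_bounded compact_differences \<open>compact T\<close>)
    then obtain n where "\<And>u. u \<in> U \<Longrightarrow> norm ((B ^^ n) u) < \<delta>"
      using funpow_B_small \<delta>(1) by metis
    then have n: "norm ((B ^^ n) (x - y)) < \<delta>" if "x \<in> T" "y \<in> T" for x y
      using that by (auto simp: U_def)
    have "(a, b) \<in> (R n)\<^sup>*"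
      using chain ab PQ by blast
    then have "b \<in> P"
    proof (induction rule: rtrancl_induct)
      case (step y z)
      then obtain a b where "z \<in> T" "a \<in> T" "b \<in> T" "y - z = (B ^^ n) (a - b)"
        unfolding R_def by blast
      then have "dist y z < \<delta>"
        using n by (simp add: dist_norm)
      with \<open>z \<in> T\<close> show ?case
        using \<delta>(2)[OF step.IH, of z] PQ(3) by force
    qed (rule ab)
    then show False
      using ab PQ(4) by blast
  qed
qed

text \<open>Connectedness makes the closed piece of digit \<open>0\<close> meet the union of the
  others, and injectivity of \<open>B\<close> turns a common point into a difference. Which
  \<open>k\<close> occurs is not controlled, so the necessary condition has to be derived for every
  \<open>k\<close>.\<close>

lemma connected_self_affine_overlap:
  fixes m :: int
  assumes T: "self_affine ((\<lambda>k. of_int k *\<^sub>R v) ` {0..m}) T"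
    and "connected T" and "m \<ge> 1"
  obtains k x y where "k \<in> {1..m}" "x \<in> T" "y \<in> T" "x - y = of_int k *\<^sub>R v"
proof -
  define F where "F k = (\<lambda>x. B (x + of_int k *\<^sub>R v)) ` T" for k :: int
  have "T \<noteq> {}" "compact T"
    using self_affineD(1,2)[OF T] .
  have eq: "T = (\<Union>k\<in>{0..m}. F k)"
    by (subst self_affineD(3)[OF T]) (simp add: F_def)
  have "compact (F k)" for k
    unfolding F_def
    by (intro compact_continuous_image continuous_intros \<open>compact T\<close>
        linear_continuous_on_compose[OF _ linear_B])
  then have "closed (F 0)" "closed (\<Union>k\<in>{1..m}. F k)"
    by (auto intro!: closed_UN compact_imp_closed)
  moreover have "{0..m} = insert 0 {1..m}"
    using \<open>m \<ge> 1\<close> by auto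
  then have "F 0 \<union> (\<Union>k\<in>{1..m}. F k) = T"
    by (subst eq) simp
  moreover have "F 0 \<noteq> {}" "(\<Union>k\<in>{1..m}. F k) \<noteq> {}"
    using \<open>T \<noteq> {}\<close> \<open>m \<ge> 1\<close> by (auto simp: F_def)
  ultimately have "F 0 \<inter> (\<Union>k\<in>{1..m}. F k) \<noteq> {}"
    using \<open>connected T\<close> connected_closed_set[OF compact_imp_closed[OF \<open>compact T\<close>]] by blast
  then obtain k z where k: "k \<in> {1..m}" and "z \<in> F 0" "z \<in> F k"
    by blast
  then obtain x y where xy: "x \<in> T" "y \<in> T" "B x = B (y + of_int k *\<^sub>R v)"
    by (auto simp: F_def)
  then have "x - y = of_int k *\<^sub>R v"
    using injD[OF inj_B xy(3)] by simp
  then show ?thesis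
    using that k xy by blast
qed

end

section \<open>Integer matrices of size two\<close>

lemma matrix_inv_inverse:
  assumes "invertible M"
  shows "M ** matrix_inv M = mat 1" and "matrix_inv M ** M = mat 1"
  using someI_ex[OF assms[unfolded invertible_def]] unfolding matrix_inv_def by simp_all

lemma charpoly_2:
  fixes A :: "int ^ 2 ^ 2"
  shows "charpoly A = [:A$1$1 * A$2$2 - A$1$2 * A$2$1, - (A$1$1 + A$2$2), 1:]"
  by (simp add: charpoly_def det_2 mat_def)

lemma Cayley_Hamilton_2:
  fixes A :: "int ^ 2 ^ 2" and x :: "real ^ 2"
  assumes "charpoly A = [:c, b, 1:]"
  shows "real_matrix A *v (real_matrix A *v x) = - of_int b *\<^sub>R (real_matrix A *v x) - of_int c *\<^sub>R x"
proof -
  have b: "b = - (A$1$1 + A$2$2)" and c: "c = A$1$1 * A$2$2 - A$1$2 * A$2$1"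
    using assms by (simp_all add: charpoly_2)
  show ?thesis
    unfolding b c by (simp add: vec_eq_iff forall_2 matrix_vector_mult_def sum_2 algebra_simps)
qed

lemma real_root_charpoly_imp_eigenvalue:
  fixes A :: "int ^ 2 ^ 2" and l :: real
  assumes "charpoly A = [:c, b, 1:]" and "l\<^sup>2 + of_int b * l + of_int c = 0"
  shows "eigenvalue A (of_real l)"
proof -
  have b: "b = - (A$1$1 + A$2$2)" and c: "c = A$1$1 * A$2$2 - A$1$2 * A$2$1"
    using assms(1) by (simp_all add: charpoly_2)
  define M where "M = map_matrix of_int A - mat (complex_of_real l)"
  have "det M = complex_of_real (l\<^sup>2 + of_int b * l + of_int c)"
    by (simp add: M_def det_2 mat_def b c algebra_simps power2_eq_square)
  then have "\<not> invertible M"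
    using assms(2) by (simp add: invertible_det_nz)
  then obtain x where x: "M *v x = 0" "x \<noteq> 0"
    using matrix_left_invertible_ker[of M] invertible_left_inverse[of M] by blast
  have "map_matrix of_int A *v x = of_real l *s x"
    using x(1) unfolding M_def
    by (simp add: vec_eq_iff forall_2 matrix_vector_mult_def sum_2 mat_def algebra_simps)
  with x(2) show ?thesis
    by (auto simp: eigenvalue_def)
qed

lemma int_quadratic_real_roots:
  fixes b c :: int
  assumes "b\<^sup>2 - 4 * c \<ge> 0"
  obtains r s :: real where "r + s = - of_int b" and "r * s = of_int c"
    and "r\<^sup>2 + of_int b * r + of_int c = 0" and "s\<^sup>2 + of_int b * s + of_int c = 0"
proof -
  define d where "d = sqrt (of_int (b\<^sup>2 - 4 * c))"
  have d: "d * d = of_int b * of_int b - 4 * of_int c"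
    using assms by (simp add: d_def power2_eq_square of_int_0_le_iff[symmetric, where 'a = real] del: of_int_0_le_iff)
  show ?thesis
    by (rule that[of "(- of_int b + d) / 2" "(- of_int b - d) / 2"])
      (simp_all add: power2_eq_square field_simps d)
qed

section \<open>Bounded solutions of the integer recurrence\<close>

text \<open>For \<open>c > 0\<close> the roots share a sign, so \<open>\<bar>b\<bar>\<close> is the
  sum of their moduli; expand \<open>(\<bar>r\<bar> - 2) * (\<bar>s\<bar> - 2) \<ge> 0\<close>. For
  \<open>c < 0\<close> it is the distance of the moduli; expand
  \<open>(\<bar>r\<bar> + 2) * (\<bar>s\<bar> - 2) \<ge> 0\<close> or its mirror image.\<close>

lemma coeff_bounds_of_large_roots:
  fixes b c :: int and r s :: real
  assumes rs: "r + s = - of_int b" "r * s = of_int c" and r: "\<bar>r\<bar> \<ge> 2" and s: "\<bar>s\<bar> \<ge> 2"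
  shows "c > 0 \<Longrightarrow> \<bar>b\<bar> = \<bar>r\<bar> + \<bar>s\<bar>"
    and "c > 0 \<Longrightarrow> \<bar>b\<bar> \<ge> 4"
    and "c > 0 \<Longrightarrow> c \<ge> 2 * \<bar>b\<bar> - 4"
    and "c < 0 \<Longrightarrow> \<bar>c\<bar> \<ge> 2 * \<bar>b\<bar> + 4"
proof -
  have b: "\<bar>b\<bar> = \<bar>r + s\<bar>"
    by (simp add: rs)
  have c: "\<bar>c\<bar> = \<bar>r\<bar> * \<bar>s\<bar>"
    by (simp add: rs flip: abs_mult)
  show sum: "\<bar>b\<bar> = \<bar>r\<bar> + \<bar>s\<bar>" if "c > 0"
  proof -
    have "r * s > 0"
      using that rs by simp
    then show ?thesis
      unfolding b by (auto simp: zero_less_mult_iff abs_if)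
  qed
  show "\<bar>b\<bar> \<ge> 4" if "c > 0"
    using sum[OF that] r s by linarith
  show "c \<ge> 2 * \<bar>b\<bar> - 4" if "c > 0"
  proof -
    have "0 \<le> (\<bar>r\<bar> - 2) * (\<bar>s\<bar> - 2)"
      using r s by simp
    also have "\<dots> = of_int \<bar>c\<bar> - 2 * of_int \<bar>b\<bar> + 4"
      using sum[OF that] c by (simp add: algebra_simps)
    finally show ?thesis
      using that by linarith
  qed
  show "\<bar>c\<bar> \<ge> 2 * \<bar>b\<bar> + 4" if "c < 0"
  proof -
    have "r * s < 0"
      using that rs by simp
    then have diff: "\<bar>b\<bar> = \<bar>\<bar>r\<bar> - \<bar>s\<bar>\<bar>"
      unfolding b by (auto simp: mult_less_0_iff abs_if)
    have "0 \<le> (\<bar>r\<bar> + 2) * (\<bar>s\<bar> - 2)" "0 \<le> (\<bar>r\<bar> - 2) * (\<bar>s\<bar> + 2)"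
      using r s by simp_all
    then have "2 * \<bar>\<bar>r\<bar> - \<bar>s\<bar>\<bar> + 4 \<le> \<bar>r\<bar> * \<bar>s\<bar>"
      by (cases "\<bar>s\<bar> \<le> \<bar>r\<bar>") (simp_all add: algebra_simps)
    then show ?thesis
      unfolding diff[symmetric] c[symmetric] by linarith
  qed
qed

lemma bounded_int_recurrence_necessary:
  fixes q :: "nat \<Rightarrow> int" and b c k m :: int and r s :: real
  assumes rs: "r + s = - of_int b" "r * s = of_int c" and r: "\<bar>r\<bar> \<ge> 2" and s: "\<bar>s\<bar> \<ge> 2"
    and bdd: "bounded (range (\<lambda>n. real_of_int (q n)))"
    and q: "q 0 = 0" "q 1 = k" "\<And>n. \<bar>q (Suc (Suc n)) + b * q (Suc n) + c * q n\<bar> \<le> m"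
    and k: "k \<ge> 1"
  shows "c = 4 \<Longrightarrow> m \<ge> 2"
    and "c > 0 \<Longrightarrow> c \<noteq> 4 \<Longrightarrow> m \<ge> max (c - \<bar>b\<bar> + 1) (\<bar>b\<bar> - 1)"
    and "c < 0 \<Longrightarrow> m \<ge> \<bar>c\<bar> - \<bar>b\<bar> - 1"
proof -
  note bounds = coeff_bounds_of_large_roots[OF rs r s]
  have pos: "(c - \<bar>b\<bar> + 1) * \<bar>q n\<bar> \<le> m" if "c > 0" for n
  proof -
    have "real_of_int \<bar>q (Suc (Suc n)) + b * q (Suc n) + c * q n\<bar> \<le> of_int m" for n
      using q(3)[of n] by (simp only: of_int_le_iff)
    then have "\<bar>real_of_int (q (Suc (Suc n))) - (r + s) * q (Suc n) + r * s * q n\<bar> \<le> m" for n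
      by (simp add: rs)
    then have "(\<bar>r\<bar> - 1) * (\<bar>s\<bar> - 1) * \<bar>real_of_int (q n)\<bar> \<le> m"
      using r s by (intro bounded_recurrence2_abs_le[OF bdd]) auto
    moreover have "(\<bar>r\<bar> - 1) * (\<bar>s\<bar> - 1) = \<bar>r * s\<bar> - (\<bar>r\<bar> + \<bar>s\<bar>) + 1"
      by (simp add: algebra_simps abs_mult)
    then have "(\<bar>r\<bar> - 1) * (\<bar>s\<bar> - 1) = of_int (c - \<bar>b\<bar> + 1)"
      using that rs(2) bounds(1) by simp
    ultimately have "real_of_int ((c - \<bar>b\<bar> + 1) * \<bar>q n\<bar>) \<le> of_int m"
      by simp
    then show ?thesis
      by (simp only: of_int_le_iff)
  qed
  \<comment> \<open>The recurrence at \<open>0\<close> reads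
    \<open>\<bar>q 2 + b * k\<bar> \<le> m\<close>, which forces
    \<open>\<bar>q 2\<bar> \<ge> 2\<close> and so doubles the bound from \<open>pos\<close>.\<close>
  have q2: "2 * (c - \<bar>b\<bar> + 1) \<le> m" if "c > 0" "m \<le> \<bar>b\<bar> - 2"
  proof -
    have "\<bar>q 2 + b * k\<bar> \<le> m"
      using q(3)[of 0] q(1,2) by (simp add: numeral_2_eq_2)
    moreover have "\<bar>b\<bar> \<le> \<bar>b * k\<bar>"
      using k by (simp add: abs_mult mult_le_cancel_left1)
    ultimately have "2 \<le> \<bar>q 2\<bar>"
      using that by linarith
    then have "(c - \<bar>b\<bar> + 1) * 2 \<le> (c - \<bar>b\<bar> + 1) * \<bar>q 2\<bar>"
      using bounds(2,3) that by (intro mult_left_mono) auto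
    with pos[OF that(1), of 2] show ?thesis
      by simp
  qed
  show "m \<ge> 2" if "c = 4"
  proof (rule ccontr)
    assume "\<not> m \<ge> 2"
    \<comment> \<open>For \<open>c = 4\<close> the bounds force \<open>\<bar>b\<bar> = 4\<close>, so
      \<open>c - \<bar>b\<bar> + 1 = 1\<close> and \<open>q2\<close> yields
      \<open>2 \<le> m\<close>.\<close>
    moreover have "m \<le> \<bar>b\<bar> - 2"
      using bounds(2) that calculation by simp
    ultimately show False
      using q2 bounds(3) that by simp
  qed
  show "m \<ge> max (c - \<bar>b\<bar> + 1) (\<bar>b\<bar> - 1)" if "c > 0" "c \<noteq> 4"
  proof -
    have "(c - \<bar>b\<bar> + 1) * 1 \<le> (c - \<bar>b\<bar> + 1) * \<bar>q 1\<bar>"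
      using bounds(2,3) that k q(2) by (intro mult_left_mono) auto
    then have "c - \<bar>b\<bar> + 1 \<le> m"
      using pos[OF that(1), of 1] by simp
    \<comment> \<open>Otherwise \<open>q2\<close> gives
      \<open>2 * c \<le> 3 * \<bar>b\<bar> - 4\<close>; with
      \<open>c \<ge> 2 * \<bar>b\<bar> - 4\<close> and \<open>\<bar>b\<bar> \<ge> 4\<close> only
      \<open>c = 4\<close> remains.\<close>
    moreover have "\<bar>b\<bar> - 1 \<le> m"
    proof (rule ccontr)
      assume "\<not> \<bar>b\<bar> - 1 \<le> m"
      then show False
        using q2 bounds(2,3) that by simp
    qed
    ultimately show ?thesis
      by simp
  qed
  \<comment> \<open>For opposite signs \<open>(\<bar>r\<bar> - 1) * (\<bar>s\<bar> - 1)\<close> is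
    smaller than \<open>\<bar>c\<bar> - \<bar>b\<bar> - 1\<close>, so a maximum argument replaces
    the root bound.\<close>
  show "m \<ge> \<bar>c\<bar> - \<bar>b\<bar> - 1" if "c < 0"
  proof -
    obtain K where K: "\<And>n. \<bar>real_of_int (q n)\<bar> \<le> K"
      using bdd by (auto simp: bounded_iff)
    have "nat \<bar>q n\<bar> < Suc (nat \<lceil>K\<rceil>)" for n
      using K[of n] by linarith
    \<comment> \<open>A bounded integer sequence attains its largest modulus; here it is at least
      \<open>q 1 = k \<ge> 1\<close>.\<close>
    then obtain N where "\<And>n. nat \<bar>q n\<bar> \<le> nat \<bar>q N\<bar>"
      using ex_has_greatest_nat[of "\<lambda>_. True" 0 "\<lambda>n. nat \<bar>q n\<bar>"] by blast
    then have N: "\<bar>q n\<bar> \<le> \<bar>q N\<bar>" for n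
      by (simp add: nat_le_eq_zle)
    have "\<bar>c\<bar> * \<bar>q N\<bar> \<le> m + \<bar>q (Suc (Suc N))\<bar> + \<bar>b * q (Suc N)\<bar>"
      using q(3)[of N] unfolding abs_mult[symmetric] by linarith
    also have "\<bar>b * q (Suc N)\<bar> \<le> \<bar>b\<bar> * \<bar>q N\<bar>"
      unfolding abs_mult using N by (intro mult_left_mono) auto
    finally have "(\<bar>c\<bar> - \<bar>b\<bar> - 1) * \<bar>q N\<bar> \<le> m"
      using N[of "Suc (Suc N)"] by (simp add: algebra_simps)
    moreover have "(\<bar>c\<bar> - \<bar>b\<bar> - 1) * 1 \<le> (\<bar>c\<bar> - \<bar>b\<bar> - 1) * \<bar>q N\<bar>"
      using bounds(4) that N[of 1] q(2) k by (intro mult_left_mono) auto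
    ultimately show ?thesis
      by simp
  qed
qed

text \<open>The solution is \<open>q n = u ^ (n - 1)\<close> for a sign \<open>u\<close>, except when \<open>c = 4\<close>: then both
  roots are \<open>2 u\<close>, and doubling the terms from \<open>q 2\<close> on lets the smaller \<open>m = 2\<close> suffice.\<close>

lemma bounded_int_recurrence_sufficient:
  fixes b c m :: int and r s :: real
  assumes rs: "r + s = - of_int b" "r * s = of_int c" and r: "\<bar>r\<bar> \<ge> 2" and s: "\<bar>s\<bar> \<ge> 2"
    and m: "c = 4 \<Longrightarrow> m \<ge> 2"
      "c > 0 \<Longrightarrow> c \<noteq> 4 \<Longrightarrow> m \<ge> max (c - \<bar>b\<bar> + 1) (\<bar>b\<bar> - 1)"
      "c < 0 \<Longrightarrow> m \<ge> \<bar>c\<bar> - \<bar>b\<bar> - 1"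
  shows "\<exists>q :: nat \<Rightarrow> int. bounded (range (\<lambda>n. real_of_int (q n))) \<and> q 0 = 0 \<and> q 1 = 1 \<and>
      (\<forall>n. \<bar>q (Suc (Suc n)) + b * q (Suc n) + c * q n\<bar> \<le> m)"
proof -
  note bounds = coeff_bounds_of_large_roots[OF rs r s]
  have c0: "c \<noteq> 0"
    using rs(2) r s by auto
  \<comment> \<open>This sign makes \<open>b * u\<close> equal to \<open>- \<bar>b\<bar>\<close> for
    \<open>c > 0\<close> and to \<open>\<bar>b\<bar>\<close> for \<open>c < 0\<close>, so that
    \<open>1 + b * u + c\<close> is as close to \<open>0\<close> as a sign allows.\<close>
  define u :: int where "u = (if (c > 0) = (b > 0) then - 1 else 1)"
  have u2: "u * u = 1" and u_abs: "\<bar>u\<bar> = 1"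
    by (simp_all add: u_def)
  define a :: int where "a = (if c = 4 then 2 else 1)"
  define q where "q n = (if n = 0 then 0 else if n = 1 then 1 else a * u ^ (n - 1))" for n :: nat
  have un: "\<bar>u ^ n\<bar> = 1" for n
    by (simp add: power_abs u_abs)
  have "\<bar>q n\<bar> \<le> 2" for n
    by (simp add: q_def a_def abs_mult un)
  then have "norm (real_of_int (q n)) \<le> 2" for n
    by (metis of_int_abs of_int_le_iff of_int_numeral real_norm_def)
  then have "bounded (range (\<lambda>n. real_of_int (q n)))"
    unfolding bounded_iff by blast
  moreover have "\<bar>q (Suc (Suc n)) + b * q (Suc n) + c * q n\<bar> \<le> m" for n
  proof -
    \<comment> \<open>\<open>q 0 = 0\<close> and \<open>q 1 = 1\<close> break the geometric pattern.
      For \<open>c > 0\<close>, \<open>c \<noteq> 4\<close> the case \<open>n = 0\<close> produces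
      \<open>\<bar>b\<bar> - 1\<close>; for \<open>c = 4\<close>, where
      \<open>\<bar>b\<bar> = 4\<close>, all three values have modulus \<open>2\<close>.\<close>
    consider "n = 0" | "n = 1" | l where "n = Suc (Suc l)"
      by (metis One_nat_def not0_implies_Suc)
    then show ?thesis
    proof cases
      case 1
      then have "q (Suc (Suc n)) + b * q (Suc n) + c * q n = a * u + b"
        by (simp add: q_def)
      also have "\<bar>\<dots>\<bar> \<le> m"
        using bounds(2-4) m c0 by (auto simp: a_def u_def abs_if max_def split: if_splits)
      finally show ?thesis .
    next
      case 2
      then have "q (Suc (Suc n)) + b * q (Suc n) + c * q n = a * (1 + b * u) + c"
        by (simp add: q_def u2 algebra_simps power2_eq_square numeral_2_eq_2)
      also have "\<bar>\<dots>\<bar> \<le> m"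
        using bounds(2-4) m c0 by (auto simp: a_def u_def abs_if max_def split: if_splits)
      finally show ?thesis .
    next
      case 3
      then have "q (Suc (Suc n)) + b * q (Suc n) + c * q n = u ^ Suc l * (a * (u * u + b * u + c))"
        by (simp add: q_def algebra_simps)
      then have "\<bar>q (Suc (Suc n)) + b * q (Suc n) + c * q n\<bar> = \<bar>a * (1 + b * u + c)\<bar>"
        by (simp only: abs_mult[of "u ^ Suc l"] un u2 mult_1)
      also have "\<dots> \<le> m"
        using bounds(2-4) m c0 by (auto simp: a_def u_def abs_if max_def split: if_splits)
      finally show ?thesis .
    qed
  qed
  ultimately show ?thesis
    by (intro exI[of _ q]) (simp add: q_def)
qed

section \<open>Connectedness through the integer recurrence\<close>

theorem theorem1p1:
  fixes A :: "int ^ 2 ^ 2" and b c m :: int and v :: "real ^ 2"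
  assumes "expanding A"
    and "charpoly A = [:c, b, 1:]"
    and "m \<ge> 1"
    and "v \<noteq> real_matrix A *v v"
    and "independent {v, real_matrix A *v v}"
    and "b\<^sup>2 - 4 * c \<ge> 0"
    and "\<forall>\<mu>. eigenvalue A \<mu> \<longrightarrow> norm \<mu> \<ge> 2"
  shows "(c = 4 \<longrightarrow>
            (connected (self_affine_set A (collinear_digits m v)) \<longleftrightarrow> m \<ge> 2)) \<and>
         (c \<noteq> 4 \<longrightarrow>
            (connected (self_affine_set A (collinear_digits m v)) \<longleftrightarrow>
               m \<ge> (if c > 0 then max (c - \<bar>b\<bar> + 1) (\<bar>b\<bar> - 1) else \<bar>c\<bar> - \<bar>b\<bar> - 1)))"
proof -
  obtain r s :: real where rs: "r + s = - of_int b" "r * s = of_int c"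
    and "r\<^sup>2 + of_int b * r + of_int c = 0" "s\<^sup>2 + of_int b * s + of_int c = 0"
    using int_quadratic_real_roots[OF assms(6)] by blast
  \<comment> \<open>Both roots are real eigenvalues, so the hypothesis on the moduli applies to
    \<open>r\<close> and \<open>s\<close>.\<close>
  then have "eigenvalue A (of_real r)" "eigenvalue A (of_real s)"
    using real_root_charpoly_imp_eigenvalue[OF assms(2)] by blast+
  then have large: "\<bar>r\<bar> \<ge> 2" "\<bar>s\<bar> \<ge> 2"
    using assms(7) by fastforce+
  then have "c \<noteq> 0"
    using rs(2) by auto
  have "c = A$1$1 * A$2$2 - A$1$2 * A$2$1"
    using assms(2) by (simp add: charpoly_2)
  then have "det (real_matrix A) = of_int c"
    by (simp add: det_2)
  then have inv: "invertible (real_matrix A)"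
    using \<open>c \<noteq> 0\<close> by (simp add: invertible_det_nz)
  interpret split_quadratic "(*v) (real_matrix A)" "(*v) (matrix_inv (real_matrix A))" r s
  proof (rule split_quadratic.intro)
    show "linear ((*v) (real_matrix A))"
      by (rule matrix_vector_mul_linear)
    show "real_matrix A *v (matrix_inv (real_matrix A) *v x) = x"
      "matrix_inv (real_matrix A) *v (real_matrix A *v x) = x" for x
      using matrix_inv_inverse[OF inv] by (simp_all add: matrix_vector_mul_assoc)
    show "real_matrix A *v (real_matrix A *v x) = (r + s) *\<^sub>R (real_matrix A *v x) - (r * s) *\<^sub>R x" for x
      using Cayley_Hamilton_2[OF assms(2)] by (simp add: rs)
  qed (rule large)+
  define D where "D = collinear_digits m v"
  have D: "D = (\<lambda>k. of_int k *\<^sub>R v) ` {0..m}" "finite D" "D \<noteq> {}"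
    using \<open>m \<ge> 1\<close> by (simp_all add: D_def collinear_digits_def)
  define T where "T = attractor D"
  have T: "self_affine_set A D = T"
    unfolding self_affine_set_def T_def using the_self_affine[OF D(2,3)] .
  have affT: "self_affine ((\<lambda>k. of_int k *\<^sub>R v) ` {0..m}) T"
    using self_affine_attractor[OF D(2,3)] unfolding T_def D(1) .
  have diffD: "{d - d' |d d'. d \<in> D \<and> d' \<in> D} = (\<lambda>e. of_int e *\<^sub>R v) ` {-m..m}"
  proof (intro equalityI subsetI)
    fix x assume "x \<in> {d - d' |d d'. d \<in> D \<and> d' \<in> D}"
    then obtain i j where "i \<in> {0..m}" "j \<in> {0..m}" "x = of_int i *\<^sub>R v - of_int j *\<^sub>R v"
      by (auto simp: D(1))
    then show "x \<in> (\<lambda>e. of_int e *\<^sub>R v) ` {-m..m}"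
      by (intro image_eqI[of _ _ "i - j"]) (auto simp: scaleR_diff_left)
  next
    fix x assume "x \<in> (\<lambda>e. of_int e *\<^sub>R v) ` {-m..m}"
    then obtain e where e: "e \<in> {-m..m}" "x = of_int e *\<^sub>R v"
      by auto
    \<comment> \<open>The positive and negative parts of \<open>e\<close> both lie between
      \<open>0\<close> and \<open>m\<close>.\<close>
    then have "x = of_int (max e 0) *\<^sub>R v - of_int (max (- e) 0) *\<^sub>R v"
      by (simp add: max_def flip: scaleR_diff_left)
    moreover have "of_int (max e 0) *\<^sub>R v \<in> D" "of_int (max (- e) 0) *\<^sub>R v \<in> D"
      using e(1) \<open>m \<ge> 1\<close> unfolding D(1) by (auto intro!: imageI)
    ultimately show "x \<in> {d - d' |d d'. d \<in> D \<and> d' \<in> D}"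
      by blast
  qed
  have diffT: "{x - y |x y. x \<in> T \<and> y \<in> T} = attractor ((\<lambda>e. of_int e *\<^sub>R v) ` {-m..m})"
    unfolding T_def attractor_differences[OF D(2,3)] diffD ..
  note mem_iff = multiple_mem_attractor_iff[OF assms(4,5) rs, where m = m, folded diffT]
  have nec: "(c = 4 \<longrightarrow> m \<ge> 2) \<and> (c > 0 \<longrightarrow> c \<noteq> 4 \<longrightarrow> m \<ge> max (c - \<bar>b\<bar> + 1) (\<bar>b\<bar> - 1)) \<and>
      (c < 0 \<longrightarrow> m \<ge> \<bar>c\<bar> - \<bar>b\<bar> - 1)" if conn: "connected T"
  proof -
    obtain k x y where k: "k \<in> {1..m}" and "x \<in> T" "y \<in> T" "x - y = of_int k *\<^sub>R v"
      using connected_self_affine_overlap[OF affT conn \<open>m \<ge> 1\<close>] .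
    then have "of_int k *\<^sub>R v \<in> {x - y |x y. x \<in> T \<and> y \<in> T}"
      by force
    then obtain q :: "nat \<Rightarrow> int" where "bounded (range (\<lambda>n. real_of_int (q n)))" "q 0 = 0" "q 1 = k"
        "\<And>n. \<bar>q (Suc (Suc n)) + b * q (Suc n) + c * q n\<bar> \<le> m"
      unfolding mem_iff by blast
    from bounded_int_recurrence_necessary[OF rs large this] k show ?thesis
      by simp
  qed
  have suf: "connected T" if "(c = 4 \<longrightarrow> m \<ge> 2) \<and> (c < 0 \<longrightarrow> m \<ge> \<bar>c\<bar> - \<bar>b\<bar> - 1) \<and>
      (c > 0 \<longrightarrow> c \<noteq> 4 \<longrightarrow> m \<ge> max (c - \<bar>b\<bar> + 1) (\<bar>b\<bar> - 1))"
  proof -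
    have "of_int 1 *\<^sub>R v \<in> {x - y |x y. x \<in> T \<and> y \<in> T}"
      unfolding mem_iff using bounded_int_recurrence_sufficient[OF rs large] that by blast
    then obtain x y where "x \<in> T" "y \<in> T" "x - y = v"
      by auto
    then show ?thesis
      using connected_self_affine[OF affT] by blast
  qed
  have "connected T \<longleftrightarrow> (c = 4 \<longrightarrow> m \<ge> 2) \<and>
      (c > 0 \<longrightarrow> c \<noteq> 4 \<longrightarrow> m \<ge> max (c - \<bar>b\<bar> + 1) (\<bar>b\<bar> - 1)) \<and>
      (c < 0 \<longrightarrow> m \<ge> \<bar>c\<bar> - \<bar>b\<bar> - 1)"
    using nec suf by blast
  \<comment> \<open>As \<open>c \<noteq> 0\<close>, the \<open>else\<close> branch of the bound is
    exactly the case \<open>c < 0\<close>.\<close>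
  moreover have "c > 0 \<or> c < 0"
    using \<open>c \<noteq> 0\<close> by linarith
  ultimately show ?thesis
    unfolding T[unfolded D_def] by (elim disjE) simp_all
qed

end
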